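(* Let $C^{\mathrm{cv}}_n$ be the number of key comparisons of the dual-pivot quicksort algorithm ``Clairvoyant'' (described in the context) on a uniformly random input of $n$ distinct elements. For $n\ge4$, \[ \mathbb{E}[C^{\mathrm{cv}}_n]=\frac95nH_n+\frac15nH^{\mathrm{alt}}_n-\frac{89}{25}n+\frac{77}{40}H_n+\frac3{40}H^{\mathrm{alt}}_n+\frac{67}{800}-\frac{(-1)^n}{10}+\frac{[n\text{ even}]}{320}\Bigl(\frac1{n-3}+\frac3{n-1}\Bigr)-\frac{[n\text{ odd}]}{320}\Bigl(\frac3{n-2}+\frac1n\Bigr). \]
   Context: $H_n=\sum_{m=1}^n\frac1m$, $H^{\mathrm{alt}}_n=\sum_{m=1}^n\frac{(-1)^m}m$; $[P]=1$ if $P$ is true and $0$ otherwise. Dual-pivot quicksort ``Clairvoyant'': the input $(a_1,\dots,a_n)$ consists of $n$ distinct elements in uniformly random order. If $n\le1$ nothing is done. Otherwise $a_1,a_n$ are compared once, giving $p=\min(a_1,a_n)$, $q=\max(a_1,a_n)$. Then $a_2,\dots,a_{n-1}$ are classified in this order as small ($<p$), medium (between $p$ and $q$) or large ($>q$): each element is first compared with one pivot and, if this does not determine its class, also with the other. Let $s,\ell$ be the total numbers of small and large elements among $a_2,\dots,a_{n-1}$ (given by an oracle) and $s_t,\ell_t$ the numbers of small resp. large elements among the first $t$ classified ones; when classifying the $(t+1)$-st element, compare with $p$ first if $s-s_t\ge\ell-\ell_t$, otherwise with $q$ first. The algorithm then recurses with the same procedure on the small, medium and large elements. $C^{\mathrm{cv}}_n$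 is the total number of comparisons. *)

theory Defs
  imports "HOL-Probability.Probability"
begin

definition alt_harm :: "nat \<Rightarrow> real" where
  "alt_harm n = (\<Sum>m=1..n. (-1) ^ m / real m)"

definition num_small :: "'a::linorder \<Rightarrow> 'a list \<Rightarrow> nat" where
  "num_small p ys = length (filter (\<lambda>y. y < p) ys)"

definition num_large :: "'a::linorder \<Rightarrow> 'a list \<Rightarrow> nat" where
  "num_large q ys = length (filter (\<lambda>y. q < y) ys)"

text \<open>
  The strategy used after \<open>t\<close> elements of \<open>ys\<close> have been classified: whether the next one
  is compared with the smaller pivot \<open>p\<close> first. Differences are taken in the integers.
\<close>
definition smaller_pivot_first :: "'a::linorder \<Rightarrow> 'a \<Rightarrow> 'a list \<Rightarrow> nat \<Rightarrow> bool" where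
  "smaller_pivot_first p q ys t \<longleftrightarrow>
     int (num_small p ys) - int (num_small p (take t ys))
       \<ge> int (num_large q ys) - int (num_large q (take t ys))"

text \<open>
  Comparisons needed to classify one element \<open>y\<close>: the second comparison is made exactly
  when the first one leaves the class undetermined.
\<close>
definition classify_comparisons :: "bool \<Rightarrow> 'a::linorder \<Rightarrow> 'a \<Rightarrow> 'a \<Rightarrow> nat" where
  "classify_comparisons p_first p q y =
     (if p_first then (if y < p then 1 else 2) else (if q < y then 1 else 2))"

definition partition_comparisons :: "'a::linorder \<Rightarrow> 'a \<Rightarrow> 'a list \<Rightarrow> nat" where
  "partition_comparisons p q ys =
     (\<Sum>t<length ys. classify_comparisons (smaller_pivot_first p q ys t) p q (ys ! t))"

text \<open>
  Total number of key comparisons of ``Clairvoyant''; look-ups of the oracle are free.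
  The recursive calls receive their elements in the order in which they were classified.
\<close>
function cv_comparisons :: "'a::linorder list \<Rightarrow> nat" where
  "cv_comparisons xs =
     (if length xs \<le> 1 then 0
      else let p = min (hd xs) (last xs);
               q = max (hd xs) (last xs);
               ys = butlast (tl xs)
           in 1 + partition_comparisons p q ys
                + cv_comparisons (filter (\<lambda>y. y < p) ys)
                + cv_comparisons (filter (\<lambda>y. p < y \<and> y < q) ys)
                + cv_comparisons (filter (\<lambda>y. q < y) ys))"
  by pat_completeness auto
termination
  by (relation "Wellfounded.measure length") (auto intro!: le_less_trans[OF length_filter_le])

declare cv_comparisons.simps [simp del]

definition expected_cv_comparisons :: "'a::linorder set \<Rightarrow> real" where
  "expected_cv_comparisons A =
     measure_pmf.expectation (pmf_of_set (permutations_of_set A)) (\<lambda>xs. real (cv_comparisons xs))"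

end

theory Submission
  imports Defs
begin

text \<open>
  With \<open>s\<close> small and \<open>l\<close> large elements left, the clairvoyant strategy pays an avoidable second
  comparison for the next element with probability proportional to \<open>min s l\<close>. Given the numbers of
  small, medium and large elements, their order is uniformly random, so the expected partitioning
  cost obeys a linear recurrence driven by \<open>min s l\<close>; since removing one element from a uniformly
  random split leaves a uniformly random split, its sums over the antidiagonals \<open>s + l = n - 1\<close>
  have a closed form. Taking second differences turns the quicksort recurrence into a
  three-term recurrence, which the claimed formula satisfies from \<open>n = 4\<close> on.
\<close>

section \<open>Averages over uniformly random permutations\<close>

abbreviation perm_avg :: "'a set \<Rightarrow> ('a list \<Rightarrow> real) \<Rightarrow> real" where
  "perm_avg A f \<equiv> measure_pmf.expectation (pmf_of_set (permutations_of_set A)) f"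

lemma integrable_perm:
  "finite A \<Longrightarrow>
     integrable (measure_pmf (pmf_of_set (permutations_of_set A))) (f :: _ \<Rightarrow> real)"
  by (intro integrable_measure_pmf_finite) simp

lemma perm_avg_altdef:
  "finite A \<Longrightarrow> perm_avg A f = (\<Sum>xs\<in>permutations_of_set A. f xs) / fact (card A)"
  by (subst integral_pmf_of_set) auto

lemma perm_avg_cong:
  assumes "finite A" "\<And>xs. set xs = A \<Longrightarrow> distinct xs \<Longrightarrow> f xs = g xs"
  shows "perm_avg A f = perm_avg A g"
  unfolding perm_avg_altdef[OF assms(1)]
  by (intro arg_cong2[where f = "(/)"] sum.cong) (auto simp: permutations_of_set_def intro: assms(2))

text \<open>The first element of a random permutation is uniform in \<open>A\<close>, and the rest
  is a random permutation of what remains. Multiplying by the cardinality makes the identity hold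
  for empty \<open>A\<close> as well.\<close>

lemma perm_avg_Cons:
  assumes "finite A"
  shows "real (card A) * perm_avg A f = (\<Sum>a\<in>A. perm_avg (A - {a}) (\<lambda>xs. f (a # xs)))"
proof (cases "A = {}")
  case False
  define n where "n = card A - 1"
  have n: "card A = Suc n" using False assms by (simp add: n_def card_gt_0_iff)
  have "(\<Sum>xs\<in>permutations_of_set A. f xs) =
        (\<Sum>a\<in>A. \<Sum>xs\<in>(#) a ` permutations_of_set (A - {a}). f xs)"
    unfolding permutations_of_set_nonempty[OF False]
    by (rule sum.UNION_disjoint) (use assms in auto)
  also have "\<dots> = (\<Sum>a\<in>A. \<Sum>xs\<in>permutations_of_set (A - {a}). f (a # xs))"
    by (simp add: sum.reindex)
  also have "\<dots> = (\<Sum>a\<in>A. fact n * perm_avg (A - {a}) (\<lambda>xs. f (a # xs)))"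
    using assms n by (intro sum.cong) (auto simp: perm_avg_altdef)
  finally show ?thesis
    using assms n
    by (simp add: perm_avg_altdef sum_distrib_left [symmetric] del: of_nat_Suc)
       (simp add: sum_divide_distrib)
qed auto

lemma perm_avg_rev:
  assumes "finite A"
  shows "perm_avg A (\<lambda>xs. f (rev xs)) = perm_avg A f"
proof -
  have "(\<Sum>xs\<in>permutations_of_set A. f (rev xs)) = (\<Sum>xs\<in>rev ` permutations_of_set A. f xs)"
    by (subst sum.reindex) auto
  then show ?thesis using assms by (simp add: perm_avg_altdef)
qed

lemma perm_avg_snoc:
  assumes "finite A"
  shows "real (card A) * perm_avg A f = (\<Sum>a\<in>A. perm_avg (A - {a}) (\<lambda>xs. f (xs @ [a])))"
proof -
  have "real (card A) * perm_avg A f = (\<Sum>a\<in>A. perm_avg (A - {a}) (\<lambda>xs. f (rev xs @ [a])))"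
    using perm_avg_Cons[OF assms, of "\<lambda>xs. f (rev xs)"] perm_avg_rev[OF assms, of f] by simp
  also have "\<dots> = (\<Sum>a\<in>A. perm_avg (A - {a}) (\<lambda>xs. f (xs @ [a])))"
    by (intro sum.cong refl perm_avg_rev) (use assms in auto)
  finally show ?thesis .
qed

text \<open>The pivots are the two end elements, so one conditions on both; the elements in between
  remain in uniformly random order.\<close>

lemma perm_avg_ends:
  assumes "finite A"
  shows "real (card A) * (real (card A) - 1) * perm_avg A f =
    (\<Sum>a\<in>A. \<Sum>b\<in>A - {a}. perm_avg (A - {a} - {b}) (\<lambda>ys. f (a # ys @ [b])))"
proof -
  have "real (card A) * (real (card A) - 1) * perm_avg A f =
    (\<Sum>a\<in>A. (real (card A) - 1) * perm_avg (A - {a}) (\<lambda>xs. f (a # xs)))"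
    unfolding sum_distrib_left[symmetric] perm_avg_Cons[OF assms, of f, symmetric] by simp
  also have "\<dots> = (\<Sum>a\<in>A. \<Sum>b\<in>A - {a}. perm_avg (A - {a} - {b}) (\<lambda>ys. f (a # ys @ [b])))"
  proof (intro sum.cong refl)
    fix a assume a: "a \<in> A"
    then have "card A \<ge> 1" using assms by (auto simp: Suc_le_eq card_gt_0_iff)
    then show "(real (card A) - 1) * perm_avg (A - {a}) (\<lambda>xs. f (a # xs)) =
       (\<Sum>b\<in>A - {a}. perm_avg (A - {a} - {b}) (\<lambda>ys. f (a # ys @ [b])))"
      using perm_avg_snoc[of "A - {a}" "\<lambda>xs. f (a # xs)"] assms a
      by (simp add: of_nat_diff)
  qed
  finally show ?thesis .
qed

text \<open>This is why the recursive calls again receive uniformly random inputs: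
  \<open>filter P\<close> is the first component of \<open>partition P\<close>, which maps a random
  permutation to a pair of independent random permutations.\<close>

lemma perm_avg_filter:
  assumes "finite A"
  shows "perm_avg A (\<lambda>xs. f (filter P xs)) = perm_avg {x\<in>A. P x} f"
proof -
  let ?p = "\<lambda>A. pmf_of_set (permutations_of_set A)"
  have "map_pmf (filter P) (?p A) = map_pmf fst (map_pmf (partition P) (?p A))"
    by (simp add: pmf.map_comp o_def)
  also have "\<dots> = ?p {x\<in>A. P x}"
    by (simp add: partition_random_permutations[OF assms] map_fst_pair_pmf)
  finally show ?thesis by (metis integral_map_pmf)
qed

section \<open>Expected comparisons of one partitioning step\<close>

text \<open>
  Expected number of small elements compared with the larger pivot first plus large elements
  compared with the smaller pivot first, for \<open>s\<close> small and \<open>l\<close> large elements in random order.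
\<close>
fun cross_cost :: "nat \<Rightarrow> nat \<Rightarrow> real" where
  "cross_cost 0 l = 0"
| "cross_cost (Suc s) 0 = 0"
| "cross_cost (Suc s) (Suc l) =
     (real (min (Suc s) (Suc l)) + real (Suc s) * cross_cost s (Suc l)
        + real (Suc l) * cross_cost (Suc s) l) / real (Suc s + Suc l)"

lemma cross_cost_0_right [simp]: "cross_cost s 0 = 0"
  by (cases s) auto

text \<open>Truncated subtraction is harmless: wherever it takes effect, the factor
  \<open>real s\<close> or \<open>real l\<close> is zero. Clearing the denominator also covers
  \<open>s = l = 0\<close>.\<close>

lemma cross_cost_rec:
  "(real s + real l) * cross_cost s l =
     real (min s l) + real s * cross_cost (s - 1) l + real l * cross_cost s (l - 1)"
  by (cases s; cases l) (auto simp: min_def)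

lemma num_small_Cons: "num_small p (y # ys) = of_bool (y < p) + num_small p ys"
  by (simp add: num_small_def)

lemma num_large_Cons: "num_large q (y # ys) = of_bool (q < y) + num_large q ys"
  by (simp add: num_large_def)

text \<open>The strategy looks only at the numbers of small and large elements still to come, so
  dropping a classified head merely shifts the time index.\<close>

lemma partition_comparisons_Cons:
  "partition_comparisons p q (y # ys) =
     classify_comparisons (num_small p (y # ys) \<ge> num_large q (y # ys)) p q y
       + partition_comparisons p q ys"
proof -
  have "smaller_pivot_first p q (y # ys) (Suc t) = smaller_pivot_first p q ys t" for t
    by (simp add: smaller_pivot_first_def num_small_Cons num_large_Cons)
  moreover have "smaller_pivot_first p q (y # ys) 0 \<longleftrightarrow> num_small p (y # ys) \<ge> num_large q (y # ys)"
    by (simp add: smaller_pivot_first_def num_small_def num_large_def)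
  ultimately show ?thesis
    by (simp add: partition_comparisons_def sum.lessThan_Suc_shift del: sum.lessThan_Suc)
qed

lemma length_filter_eq_card:
  "distinct xs \<Longrightarrow> length (filter P xs) = card {x \<in> set xs. P x}"
  by (metis distinct_card distinct_filter set_filter)

lemma card_remove_Collect:
  assumes "finite B" "y \<in> B"
  shows "card {x \<in> B - {y}. P x} = card {x \<in> B. P x} - of_bool (P y)"
proof -
  have "{x \<in> B - {y}. P x} = {x \<in> B. P x} - {y}" by auto
  then show ?thesis using assms by (auto simp: card_Diff_singleton_if)
qed

lemma sum_by_class:
  fixes B :: "'a::linorder set" and u v w :: real
  assumes "finite B" "p < q" "p \<notin> B" "q \<notin> B"
  shows "(\<Sum>y\<in>B. if y < p then u else if q < y then w else v) =
    real (card {y\<in>B. y < p}) * u + real (card {y\<in>B. p < y \<and> y < q}) * v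
      + real (card {y\<in>B. q < y}) * w"
  using assms(1,3,4)
proof (induction B rule: finite_induct)
  case (insert y B)
  have *: "card {x \<in> insert y B. P x} = of_bool (P y) + card {x\<in>B. P x}" for P
  proof -
    have "{x \<in> insert y B. P x} = (if P y then insert y {x\<in>B. P x} else {x\<in>B. P x})" by auto
    then show ?thesis using insert.hyps by simp
  qed
  have "y < p \<or> (p < y \<and> y < q) \<or> q < y" using insert.prems by force
  with insert.hyps insert.IH insert.prems assms(2) show ?case
    unfolding * by (auto simp: distrib_right)
qed simp

text \<open>Every element costs one comparison, a medium one always a second, and all other second
  comparisons are counted by \<open>cross_cost\<close>. The induction conditions on the element
  classified first.\<close>

lemma perm_avg_partition_comparisons:
  fixes B :: "'a::linorder set"
  assumes "finite B" "p < q" "p \<notin> B" "q \<notin> B"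
  shows "perm_avg B (\<lambda>ys. real (partition_comparisons p q ys)) =
    real (card B) + real (card {y\<in>B. p < y \<and> y < q})
      + cross_cost (card {y\<in>B. y < p}) (card {y\<in>B. q < y})"
  using assms(1,3,4)
proof (induction "card B" arbitrary: B)
  case 0
  then show ?case by (simp add: partition_comparisons_def pmf_of_set_singleton)
next
  case (Suc N B)
  define s m l where sml: "s = card {y\<in>B. y < p}" "m = card {y\<in>B. p < y \<and> y < q}"
    "l = card {y\<in>B. q < y}"
  have cardB: "card B = s + m + l"
    using sum_by_class[OF Suc.prems(1) assms(2) Suc.prems(2,3), of 1 1 1]
    unfolding sml by (simp flip: of_nat_add cong: if_cong)
  have step: "perm_avg (B - {y}) (\<lambda>ys. real (partition_comparisons p q (y # ys))) =
     (if y < p then 1 + of_bool (s < l) + (real N + real m + cross_cost (s - 1) l)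
      else if q < y then 1 + of_bool (s \<ge> l) + (real N + real m + cross_cost s (l - 1))
      else 2 + (real N + real m - 1 + cross_cost s l))" (is "_ = ?R") if y: "y \<in> B" for y
  proof -
    let ?k = "real (classify_comparisons (s \<ge> l) p q y)"
    have fin: "finite (B - {y})" using Suc.prems by simp
    have cN: "card (B - {y}) = N" using Suc.hyps(2) y Suc.prems by simp
    have "perm_avg (B - {y}) (\<lambda>ys. real (partition_comparisons p q (y # ys))) =
          perm_avg (B - {y}) (\<lambda>ys. ?k + real (partition_comparisons p q ys))"
    \<comment> \<open>The comparisons for \<open>y\<close> depend only on the total counts
      \<open>s\<close> and \<open>l\<close>, hence are the same for every order of the rest.\<close>
    proof (rule perm_avg_cong[OF fin])
      fix ys assume ys: "set ys = B - {y}" "distinct ys"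
      have "length (filter P (y # ys)) = card {x\<in>B. P x}" for P
        using length_filter_eq_card[of "y # ys" P] ys y by (simp only: list.set insert_Diff) simp
      then have "num_small p (y # ys) = s" "num_large q (y # ys) = l"
        unfolding num_small_def num_large_def sml by blast+
      then show "real (partition_comparisons p q (y # ys)) = ?k + real (partition_comparisons p q ys)"
        by (simp add: partition_comparisons_Cons)
    qed
    also have "\<dots> = ?k + perm_avg (B - {y}) (\<lambda>ys. real (partition_comparisons p q ys))"
      using integrable_perm[OF fin] by simp
    also have "perm_avg (B - {y}) (\<lambda>ys. real (partition_comparisons p q ys)) =
       real N + real (m - of_bool (p < y \<and> y < q))
         + cross_cost (s - of_bool (y < p)) (l - of_bool (q < y))"
      using Suc.hyps(1)[of "B - {y}"] fin cN Suc.prems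
      unfolding card_remove_Collect[OF Suc.prems(1) y] sml by simp
    also have "?k + \<dots> = ?R"
    proof -
      have "y < p \<or> (p < y \<and> y < q) \<or> q < y" using Suc.prems y by (metis linorder_neqE)
      \<comment> \<open>A medium \<open>y\<close> guarantees that \<open>m - 1\<close> is not
        truncated.\<close>
      moreover have "m \<ge> 1" if "p < y \<and> y < q"
        using that y Suc.prems by (auto simp: sml Suc_le_eq card_gt_0_iff)
      ultimately show ?thesis using assms(2)
        by (auto simp: classify_comparisons_def of_nat_diff)
    qed
    finally show ?thesis .
  qed
  have "real (Suc N) * perm_avg B (\<lambda>ys. real (partition_comparisons p q ys)) =
    real s * (1 + of_bool (s < l) + (real N + real m + cross_cost (s - 1) l))
    + real m * (2 + (real N + real m - 1 + cross_cost s l))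
    + real l * (1 + of_bool (s \<ge> l) + (real N + real m + cross_cost s (l - 1)))"
    using perm_avg_Cons[OF Suc.prems(1), of "\<lambda>ys. real (partition_comparisons p q ys)"]
      sum_by_class[OF Suc.prems(1) assms(2) Suc.prems(2,3)] Suc.hyps(2)
    by (simp add: step sml)
  also have "\<dots> = real (Suc N) * (real (Suc N) + real m + cross_cost s l)"
  proof -
    have N: "real N = real s + real m + real l - 1" using cardB Suc.hyps(2) by linarith
    \<comment> \<open>A small element pays extra exactly when \<open>s < l\<close>, a large one
      exactly when \<open>s \<ge> l\<close>; so it is always the smaller class that pays, and at a
      tie both counts agree.\<close>
    have "real (min s l) = real s * of_bool (s < l) + real l * of_bool (s \<ge> l)" by auto
    with cross_cost_rec[of s l] show ?thesis by (simp add: N algebra_simps)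
  qed
  finally show ?case using Suc.hyps(2) by (simp add: sml del: of_nat_Suc)
qed

section \<open>Summation over the ranks of the pivots\<close>

lemma sum_pairs_symmetric:
  fixes G :: "nat \<Rightarrow> nat \<Rightarrow> real"
  assumes "\<And>i j. G i j = G j i"
  shows "(\<Sum>i<n. \<Sum>j\<in>{..<n} - {i}. G i j) = 2 * (\<Sum>j<n. \<Sum>i<j. G i j)"
proof (induction n)
  case (Suc n)
  have "(\<Sum>j\<in>{..<Suc n} - {i}. G i j) = (\<Sum>j\<in>{..<n} - {i}. G i j) + G i n" if "i < n" for i
  proof -
    have "{..<Suc n} - {i} = insert n ({..<n} - {i})" using that by auto
    then show ?thesis by simp
  qed
  then have "(\<Sum>i<n. \<Sum>j\<in>{..<Suc n} - {i}. G i j) = 2 * (\<Sum>j<n. \<Sum>i<j. G i j) + (\<Sum>i<n. G i n)"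
    by (simp add: Suc sum.distrib)
  moreover have "{..<Suc n} - {n} = {..<n}" by auto
  ultimately show ?case by (simp add: assms[of n])
qed simp

text \<open>The pivots are replaced by their ranks \<open>i < j\<close> in \<open>A\<close>.\<close>
lemma sum_pivot_pairs:
  fixes A :: "'a::linorder set" and F :: "nat \<Rightarrow> nat \<Rightarrow> nat \<Rightarrow> real"
  assumes A: "finite A" "card A = n"
  shows "(\<Sum>a\<in>A. \<Sum>b\<in>A - {a}. F (card {x\<in>A. x < min a b})
            (card {x\<in>A. min a b < x \<and> x < max a b}) (card {x\<in>A. max a b < x})) =
         2 * (\<Sum>j<n. \<Sum>i<j. F i (j - i - 1) (n - 1 - j))"
proof -
  \<comment> \<open>The rank \<open>r\<close> is a bijection from \<open>A\<close> onto
    \<open>{..<n}\<close>. \<open>G\<close> is \<open>F\<close> in terms of ranks, made symmetric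
    because either end element may be the smaller pivot.\<close>
  define r where "r a = card {x\<in>A. x < a}" for a
  define G where "G i j = F (min i j) (max i j - min i j - 1) (n - 1 - max i j)" for i j
  have r_less: "r a < r b" if "a \<in> A" "a < b" for a b
    unfolding r_def by (rule psubset_card_mono) (use that A in auto)
  have inj: "inj_on r A"
    by (rule inj_onI) (metis r_less less_irrefl linorder_neqE)
  have "r a < n" if "a \<in> A" for a
    unfolding r_def A(2)[symmetric] by (rule psubset_card_mono) (use that A in auto)
  then have "r ` A \<subseteq> {..<n}" by auto
  then have img: "r ` A = {..<n}"
    using card_image[OF inj] A by (intro card_subset_eq) auto
  have between: "card {x\<in>A. a < x \<and> x < b} = r b - r a - 1" if "a \<in> A" "a < b" for a b
  proof -
    have "{x\<in>A. x < b} = {x\<in>A. x < a} \<union> insert a {x\<in>A. a < x \<and> x < b}" using that by auto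
    also have "card \<dots> = r a + Suc (card {x\<in>A. a < x \<and> x < b})"
      unfolding r_def using A by (subst card_Un_disjoint) auto
    finally show ?thesis by (simp add: r_def)
  qed
  have above: "card {x\<in>A. b < x} = n - 1 - r b" if "b \<in> A" for b
  proof -
    have "A = {x\<in>A. x < b} \<union> insert b {x\<in>A. b < x}" using that by auto
    then have "n = card ({x\<in>A. x < b} \<union> insert b {x\<in>A. b < x})" using A by simp
    also have "\<dots> = r b + Suc (card {x\<in>A. b < x})"
      unfolding r_def using A by (subst card_Un_disjoint) auto
    finally show ?thesis by simp
  qed
  have "F (card {x\<in>A. x < min a b}) (card {x\<in>A. min a b < x \<and> x < max a b})
          (card {x\<in>A. max a b < x}) = G (r a) (r b)" if "a \<in> A" "b \<in> A - {a}" for a b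
  proof (cases "a < b")
    case True
    with that r_less[of a b] between[of a b] above[of b] show ?thesis
      by (simp add: G_def min_def max_def r_def)
  next
    case False
    with that have "b < a" by auto
    with that r_less[of b a] between[of b a] above[of a] show ?thesis
      by (simp add: G_def min_def max_def r_def)
  qed
  then have "(\<Sum>a\<in>A. \<Sum>b\<in>A - {a}. F (card {x\<in>A. x < min a b})
            (card {x\<in>A. min a b < x \<and> x < max a b}) (card {x\<in>A. max a b < x})) =
        (\<Sum>a\<in>A. \<Sum>b\<in>A - {a}. G (r a) (r b))"
    by (intro sum.cong) auto
  also have "\<dots> = (\<Sum>a\<in>A. \<Sum>j\<in>{..<n} - {r a}. G (r a) j)"
  proof (rule sum.cong)
    fix a assume a: "a \<in> A"
    have "{..<n} - {r a} = r ` (A - {a})" using inj a img by (auto simp: inj_on_def)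
    then show "(\<Sum>b\<in>A - {a}. G (r a) (r b)) = (\<Sum>j\<in>{..<n} - {r a}. G (r a) j)"
      using inj by (simp add: sum.reindex inj_on_diff)
  qed simp
  also have "\<dots> = (\<Sum>i<n. \<Sum>j\<in>{..<n} - {i}. G i j)"
    by (subst img[symmetric]) (simp add: sum.reindex[OF inj])
  also have "\<dots> = 2 * (\<Sum>j<n. \<Sum>i<j. G i j)"
    by (rule sum_pairs_symmetric) (simp add: G_def min.commute max.commute)
  also have "(\<Sum>j<n. \<Sum>i<j. G i j) = (\<Sum>j<n. \<Sum>i<j. F i (j - i - 1) (n - 1 - j))"
    by (intro sum.cong refl) (simp add: G_def min_def max_def)
  finally show ?thesis .
qed

section \<open>The quicksort recurrence\<close>

text \<open>Each pair of ranks \<open>i < j\<close> has probability \<open>2 / (n * (n - 1))\<close>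
  and leaves \<open>i\<close> small, \<open>j - i - 1\<close> medium and \<open>n - 1 - j\<close>
  large elements. The term \<open>real n - 1\<close> combines the comparison of the pivots with the
  first comparison of each of the other \<open>n - 2\<close> elements.\<close>

function cv_cost :: "nat \<Rightarrow> real" where
  "cv_cost n = (if n \<le> 1 then 0 else
     2 / (real n * (real n - 1)) * (\<Sum>j<n. \<Sum>i<j.
       real n - 1 + real (j - i - 1) + cross_cost i (n - 1 - j)
       + cv_cost i + cv_cost (j - i - 1) + cv_cost (n - 1 - j)))"
  by pat_completeness auto
termination by (relation "Wellfounded.measure id") auto

declare cv_cost.simps [simp del]

lemma cv_comparisons_ends:
  "cv_comparisons (a # ys @ [b]) =
     1 + partition_comparisons (min a b) (max a b) ys
       + cv_comparisons (filter (\<lambda>y. y < min a b) ys)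
       + cv_comparisons (filter (\<lambda>y. min a b < y \<and> y < max a b) ys)
       + cv_comparisons (filter (\<lambda>y. max a b < y) ys)"
  by (subst cv_comparisons.simps) (simp add: Let_def)

lemma expected_cv_comparisons_eq_cv_cost:
  fixes A :: "'a::linorder set"
  assumes "finite A"
  shows "expected_cv_comparisons A = cv_cost (card A)"
  using assms
proof (induction "card A" arbitrary: A rule: less_induct)
  case less
  define n where "n = card A"
  show ?case
  proof (cases "n \<le> 1")
    case True
    have "perm_avg A (\<lambda>xs. real (cv_comparisons xs)) = perm_avg A (\<lambda>_. 0)"
      using True less.prems by (intro perm_avg_cong)
        (auto simp: n_def cv_comparisons.simps distinct_card[symmetric])
    then show ?thesis using True
      by (simp add: expected_cv_comparisons_def n_def cv_cost.simps)
  next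
    case False
    define F where "F s m l = real n - 1 + real m + cross_cost s l
      + cv_cost s + cv_cost m + cv_cost l" for s m l
    have avg: "perm_avg (A - {a} - {b}) (\<lambda>ys. real (cv_comparisons (a # ys @ [b]))) =
      F (card {x\<in>A. x < min a b}) (card {x\<in>A. min a b < x \<and> x < max a b}) (card {x\<in>A. max a b < x})"
      if ab: "a \<in> A" "b \<in> A - {a}" for a b
    proof -
      define p q B where pq: "p = min a b" "q = max a b" "B = A - {a} - {b}"
      have "p < q" "p \<notin> B" "q \<notin> B" "finite B" using ab less.prems by (auto simp: pq min_def max_def)
      have cB: "real (card B) = real n - 2"
        using ab less.prems False by (auto simp: pq n_def of_nat_diff)
      have IH: "perm_avg B (\<lambda>ys. real (cv_comparisons (filter P ys))) = cv_cost (card {y\<in>B. P y})" for P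
      proof -
        have "card {y\<in>B. P y} \<le> card B" using \<open>finite B\<close> by (intro card_mono) auto
        also have "card B < card A" using cB n_def by linarith
        finally show ?thesis
          using less.hyps[of "{y\<in>B. P y}"] \<open>finite B\<close>
            perm_avg_filter[of B "\<lambda>xs. real (cv_comparisons xs)" P]
          by (simp add: expected_cv_comparisons_def)
      qed
      \<comment> \<open>A pivot satisfies none of the three strict conditions, so the classes may be
        counted in \<open>A\<close>, where their sizes are given by ranks.\<close>
      have sets: "{y\<in>B. y < p} = {x\<in>A. x < p}" "{y\<in>B. p < y \<and> y < q} = {x\<in>A. p < x \<and> x < q}"
        "{y\<in>B. q < y} = {x\<in>A. q < x}"
        by (auto simp: pq min_def max_def split: if_splits)
      have "perm_avg B (\<lambda>ys. real (cv_comparisons (a # ys @ [b]))) =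
        1 + perm_avg B (\<lambda>ys. real (partition_comparisons p q ys))
        + perm_avg B (\<lambda>ys. real (cv_comparisons (filter (\<lambda>y. y < p) ys)))
        + perm_avg B (\<lambda>ys. real (cv_comparisons (filter (\<lambda>y. p < y \<and> y < q) ys)))
        + perm_avg B (\<lambda>ys. real (cv_comparisons (filter (\<lambda>y. q < y) ys)))"
        unfolding cv_comparisons_ends pq(1,2)[symmetric]
        using integrable_perm[OF \<open>finite B\<close>] by simp
      also have "\<dots> = F (card {x\<in>A. x < p}) (card {x\<in>A. p < x \<and> x < q}) (card {x\<in>A. q < x})"
        unfolding IH perm_avg_partition_comparisons[OF \<open>finite B\<close> \<open>p < q\<close> \<open>p \<notin> B\<close> \<open>q \<notin> B\<close>] sets cB F_def
        by simp
      finally show ?thesis by (simp add: pq)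
    qed
    have "real n * (real n - 1) * expected_cv_comparisons A = 
        2 * (\<Sum>j<n. \<Sum>i<j. F i (j - i - 1) (n - 1 - j))"
      unfolding expected_cv_comparisons_def n_def perm_avg_ends[OF less.prems]
      by (subst sum_pivot_pairs[OF less.prems refl, symmetric])
         (intro sum.cong refl avg, auto)
    also have "\<dots> = real n * (real n - 1) * cv_cost n"
      using False by (subst cv_cost.simps) (simp add: F_def)
    finally show ?thesis using False by (simp add: n_def)
  qed
qed

section \<open>Triangular sums and antidiagonals\<close>

text \<open>With \<open>k\<close> as second argument of \<open>g\<close>, the double sums range over
  \<open>i + k < n\<close> and \<open>i + k < n - 1\<close>; the antidiagonal
  \<open>i + k = n - 1\<close> is the difference.\<close>

lemma sum_pairs_antidiagonal:
  fixes g :: "nat \<Rightarrow> nat \<Rightarrow> real"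
  shows "(\<Sum>j<Suc n. \<Sum>i<j. g i (n - j)) = (\<Sum>j<n. \<Sum>i<j. g i (n - 1 - j)) + (\<Sum>k<n. g (n - 1 - k) k)"
proof -
  have rev: "(\<Sum>j<n. \<Sum>i<j. g i (n - 1 - j)) = (\<Sum>k<n. \<Sum>i<n - 1 - k. g i k)" for n
    by (subst sum.nat_diff_reindex[symmetric], intro sum.cong) auto
  have "(\<Sum>j<Suc n. \<Sum>i<j. g i (n - j)) = (\<Sum>k<n. \<Sum>i<n - k. g i k)"
    using rev[of "Suc n"] by simp
  also have "\<dots> = (\<Sum>k<n. (\<Sum>i<n - 1 - k. g i k) + g (n - 1 - k) k)"
  proof (intro sum.cong refl)
    fix k assume "k \<in> {..<n}"
    then have "n - k = Suc (n - 1 - k)" by auto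
    then show "(\<Sum>i<n - k. g i k) = (\<Sum>i<n - 1 - k. g i k) + g (n - 1 - k) k" by simp
  qed
  finally show ?thesis by (simp only: rev sum.distrib)
qed

text \<open>The three class sizes are equally distributed over the pivot pairs, so the three
  recursive sums merge into one.\<close>

lemma sum_pairs_first:
  fixes f :: "nat \<Rightarrow> real"
  shows "(\<Sum>j<n. \<Sum>i<j. f (j - i - 1)) = (\<Sum>j<n. \<Sum>i<j. f i)"
    and "(\<Sum>j<n. \<Sum>i<j. f (n - 1 - j)) = (\<Sum>j<n. \<Sum>i<j. f i)"
proof -
  show "(\<Sum>j<n. \<Sum>i<j. f (j - i - 1)) = (\<Sum>j<n. \<Sum>i<j. f i)"
    using sum.nat_diff_reindex[of f] by simp
  show "(\<Sum>j<n. \<Sum>i<j. f (n - 1 - j)) = (\<Sum>j<n. \<Sum>i<j. f i)"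
  proof (induction n)
    case (Suc n)
    have "(\<Sum>j<Suc n. \<Sum>i<j. f (Suc n - 1 - j)) = (\<Sum>j<n. \<Sum>i<j. f i) + (\<Sum>k<n. f k)"
      using sum_pairs_antidiagonal[of "\<lambda>_. f" n] Suc by (simp only: diff_Suc_1)
    then show ?case by (simp only: sum.lessThan_Suc)
  qed simp
qed

text \<open>The index \<open>n\<close> counts the splits, which satisfy
  \<open>s + l = n - 1\<close>.\<close>

definition cross_diag :: "nat \<Rightarrow> real" where
  "cross_diag n = (\<Sum>k<n. cross_cost (n - 1 - k) k)"

text \<open>Going down from \<open>n + 2\<close> to \<open>n\<close>, the two end terms vanish and
  each inner minimum drops by one.\<close>

lemma sum_min_antidiagonal: "(\<Sum>k\<le>n. real (min (n - k) k)) = (real n ^ 2 - of_bool (odd n)) / 4"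
proof (induction n rule: induct_nat_012)
  case (ge2 n)
  have "(\<Sum>k\<le>Suc (Suc n). real (min (Suc (Suc n) - k) k)) = (\<Sum>k\<le>n. real (min (n - k) k) + 1)"
    by (subst sum.atMost_Suc_shift, subst sum.atMost_Suc) (auto intro!: sum.cong simp: min_def)
  with ge2 show ?case by (simp add: sum.distrib power2_eq_square field_simps)
qed auto

text \<open>A split \<open>(s, l)\<close> with \<open>s + l = n\<close> is reached from
  \<open>(s + 1, l)\<close> with weight \<open>s + 1\<close> and from \<open>(s, l + 1)\<close> with
  weight \<open>l + 1\<close>. The total weight \<open>n + 2\<close> does not depend on the split,
  so the recurrence closes on the antidiagonal sums.\<close>

lemma cross_diag_rec:
  "real (Suc n) * cross_diag (Suc (Suc n)) =
     real (n + 2) * cross_diag (Suc n) + (\<Sum>k\<le>Suc n. real (min (Suc n - k) k))"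
proof -
  have "real (Suc n) * cross_diag (Suc (Suc n)) =
      (\<Sum>k\<le>Suc n. (real (Suc n - k) + real k) * cross_cost (Suc n - k) k)"
    unfolding cross_diag_def sum_distrib_left lessThan_Suc_atMost
    by (intro sum.cong) (auto simp: of_nat_diff)
  also have "\<dots> = (\<Sum>k\<le>Suc n. real (min (Suc n - k) k))
      + (\<Sum>k\<le>Suc n. real (Suc n - k) * cross_cost (Suc n - k - 1) k)
      + (\<Sum>k\<le>Suc n. real k * cross_cost (Suc n - k) (k - 1))"
    unfolding cross_cost_rec by (simp add: sum.distrib)
  also have "(\<Sum>k\<le>Suc n. real (Suc n - k) * cross_cost (Suc n - k - 1) k) =
      (\<Sum>k\<le>n. real (Suc n - k) * cross_cost (n - k) k)"
    by (simp add: diff_right_commute)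
  also have "(\<Sum>k\<le>Suc n. real k * cross_cost (Suc n - k) (k - 1)) =
      (\<Sum>k\<le>n. real (Suc k) * cross_cost (n - k) k)"
    by (subst sum.atMost_Suc_shift) simp
  also have "(\<Sum>k\<le>Suc n. real (min (Suc n - k) k)) +
      (\<Sum>k\<le>n. real (Suc n - k) * cross_cost (n - k) k) + (\<Sum>k\<le>n. real (Suc k) * cross_cost (n - k) k) =
      (\<Sum>k\<le>Suc n. real (min (Suc n - k) k)) + (\<Sum>k\<le>n. real (n + 2) * cross_cost (n - k) k)"
    unfolding add.assoc sum.distrib[symmetric] distrib_right[symmetric]
    by (intro arg_cong2[where f = "(+)"] sum.cong refl) (auto simp: of_nat_diff)
  also have "(\<Sum>k\<le>n. real (n + 2) * cross_cost (n - k) k) = real (n + 2) * cross_diag (Suc n)"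
    by (simp add: cross_diag_def sum_distrib_left lessThan_Suc_atMost)
  finally show ?thesis by simp
qed

lemma alt_harm_0 [simp]: "alt_harm 0 = 0"
  by (simp add: alt_harm_def)

lemma alt_harm_Suc: "alt_harm (Suc n) = alt_harm n + (-1) ^ Suc n / real (Suc n)"
  by (simp add: alt_harm_def)

lemma alt_harm_numeral:
  "alt_harm (Suc 0) = -1"
  "alt_harm (numeral k) = alt_harm (pred_numeral k) + (-1) ^ numeral k / numeral k"
  using alt_harm_Suc[of "pred_numeral k"] by (simp_all add: alt_harm_def flip: numeral_eq_Suc)

text \<open>Divided by \<open>(n + 1) * (n + 2)\<close>, the recurrence telescopes. The difference
  \<open>harm n - alt_harm n\<close> is twice the sum of \<open>1 / m\<close> over odd
  \<open>m \<le> n\<close>.\<close>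

lemma cross_diag_closed_form:
  "cross_diag n = (real n ^ 2 - real n * (harm n - alt_harm n) + of_bool (odd n)) / 4"
proof (induction n rule: induct_nat_012)
  case (ge2 n)
  have "cross_diag (Suc (Suc n)) =
     (real (n + 2) * cross_diag (Suc n) + (\<Sum>k\<le>Suc n. real (min (Suc n - k) k))) / real (Suc n)"
    using cross_diag_rec[of n] by (simp add: field_simps del: of_nat_Suc)
  also have "\<dots> = (real (Suc (Suc n)) ^ 2 - real (Suc (Suc n)) * (harm (Suc (Suc n)) - alt_harm (Suc (Suc n)))
       + of_bool (odd (Suc (Suc n)))) / 4"
    unfolding ge2(2) sum_min_antidiagonal
    by (cases "even n") (simp_all add: harm_Suc alt_harm_Suc divide_simps, (simp add: algebra_simps power2_eq_square)+)
  finally show ?case .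
qed (simp_all add: cross_diag_def harm_def alt_harm_def)

section \<open>Second differences of the recurrence\<close>

lemma sum_real_lessThan: "(\<Sum>j<n. real j) = real n * (real n - 1) / 2"
  by (induction n) (auto simp: field_simps)

lemma cv_cost_sum:
  "real n * (real n - 1) * cv_cost n = real n * (real n - 1)^2
     + 2 * (\<Sum>j<n. \<Sum>i<j. real i) + 2 * (\<Sum>j<n. \<Sum>i<j. cross_cost i (n - 1 - j))
     + 6 * (\<Sum>j<n. \<Sum>i<j. cv_cost i)"
proof (cases "n \<le> 1")
  case True
  then have "n = 0 \<or> n = 1" by auto
  then show ?thesis by auto
next
  case False
  have "real n * (real n - 1) * cv_cost n = 2 * (\<Sum>j<n. \<Sum>i<j. real n - 1
       + real (j - i - 1) + cross_cost i (n - 1 - j)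
       + cv_cost i + cv_cost (j - i - 1) + cv_cost (n - 1 - j))"
    using False by (subst cv_cost.simps) simp
  also have "\<dots> = 2 * ((\<Sum>j<n. real j) * (real n - 1) + (\<Sum>j<n. \<Sum>i<j. real i)
       + (\<Sum>j<n. \<Sum>i<j. cross_cost i (n - 1 - j)) + 3 * (\<Sum>j<n. \<Sum>i<j. cv_cost i))"
    unfolding sum.distrib sum_pairs_first by (simp add: sum_distrib_right)
  finally show ?thesis by (simp add: sum_real_lessThan power2_eq_square)
qed

text \<open>Two differences reduce the double sum of \<open>cv_cost\<close> to a single value; one
  difference reduces the double sum of \<open>cross_cost\<close> to
  \<open>cross_diag\<close>.\<close>

lemma cv_cost_second_difference:
  "(real n + 2) * (real n + 1) * cv_cost (n + 2) =
     2 * (real n + 1) * real n * cv_cost (n + 1) + (6 - real n * (real n - 1)) * cv_cost n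
     + 2 * (4 * real n + 1) + 2 * (cross_diag (n + 1) - cross_diag n)"
proof -
  define W where "W n = real n * (real n - 1) * cv_cost n" for n
  have *: "W (Suc n) - W n = real (Suc n) * real n ^ 2 - real n * (real n - 1)^2
     + real n * (real n - 1) + 2 * cross_diag n + 6 * (\<Sum>i<n. cv_cost i)" for n
    using sum_pairs_antidiagonal[where g = cross_cost and n = n]
    unfolding W_def cv_cost_sum cross_diag_def sum_real_lessThan
    by (simp del: sum.lessThan_Suc add: sum.lessThan_Suc[of "\<lambda>j. sum cv_cost {..<j}" n]
        sum.lessThan_Suc[of "\<lambda>j. real j * (real j - 1) / 2" n])
  \<comment> \<open>The polynomial terms of the first difference add up to
    \<open>4 * n^2 - 2 * n\<close>, whose increment is \<open>2 * (4 * n + 1)\<close>.\<close>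
  have "W (Suc (Suc n)) - 2 * W (Suc n) + W n = 
     2 * (4 * real n + 1) + 2 * (cross_diag (Suc n) - cross_diag n) + 6 * cv_cost n"
    using *[of n] *[of "Suc n"] by (simp add: algebra_simps power2_eq_square)
  then show ?thesis by (simp add: W_def algebra_simps)
qed

section \<open>Verification of the closed form\<close>

definition cv_closed_form :: "nat \<Rightarrow> real" where
  "cv_closed_form n = 9/5 * real n * harm n + 1/5 * real n * alt_harm n - 89/25 * real n
           + 77/40 * harm n + 3/40 * alt_harm n + 67/800 - (-1) ^ n / 10
           + of_bool (even n) / 320 * (1 / (real n - 3) + 3 / (real n - 1))
           - of_bool (odd n) / 320 * (3 / (real n - 2) + 1 / real n)"

text \<open>Splitting by parity fixes all signs. With \<open>H\<close>, \<open>K\<close> and the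
  reciprocals as independent variables, the difference of the two sides is a combination of
  relations such as \<open>(x + 1) * u - 1\<close>. The bound on \<open>n\<close> keeps
  \<open>x - 3\<close> and \<open>x - 2\<close> nonzero.\<close>

lemma cv_closed_form_rec:
  assumes "n \<ge> 4"
  shows "(real n + 2) * (real n + 1) * cv_closed_form (n + 2) =
     2 * (real n + 1) * real n * cv_closed_form (n + 1) + (6 - real n * (real n - 1)) * cv_closed_form n
     + 2 * (4 * real n + 1) + 2 * (cross_diag (n + 1) - cross_diag n)"
proof -
  define x where "x = real n"
  have x: "x \<ge> 4" using assms by (simp add: x_def)
  have r: "real (n + 2) = x + 2" "real (n + 1) = x + 1" "real n = x" by (simp_all add: x_def)
  have h: "harm (n + 1) = harm n + 1 / (x + 1)" "harm (n + 2) = harm n + 1 / (x + 1) + 1 / (x + 2)"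
    by (simp_all add: harm_Suc x_def field_simps)
  have k: "alt_harm (n + 1) = alt_harm n - (-1)^n / (x + 1)"
      "alt_harm (n + 2) = alt_harm n - (-1)^n / (x + 1) + (-1)^n / (x + 2)"
    by (simp_all add: alt_harm_Suc x_def add.commute)
  define H K where "H = (harm n :: real)" and "K = alt_harm n"
  define u v where "u = 1 / (x + 1)" and "v = 1 / (x + 2)"
  have uv: "(x + 1) * u = 1" "(x + 2) * v = 1" using x by (simp_all add: u_def v_def)
  define a b where "a y = 9/5 * y + 77/40" and "b y = 1/5 * y + 3/40" for y :: real
  define c where "c y = 67/800 - 89/25 * y" for y :: real
  have F: "cv_closed_form m = a (real m) * harm m + b (real m) * alt_harm m + c (real m) - (-1) ^ m / 10
           + of_bool (even m) / 320 * (1 / (real m - 3) + 3 / (real m - 1))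
           - of_bool (odd m) / 320 * (3 / (real m - 2) + 1 / real m)" for m
    by (simp add: cv_closed_form_def a_def b_def c_def algebra_simps)
  note hk = h k H_def[symmetric] K_def[symmetric] u_def[symmetric] v_def[symmetric]
  show ?thesis
  proof (cases "even n")
    case True
    then have sgn: "(-1::real) ^ n = 1" by simp
    \<comment> \<open>The poles for \<open>n\<close>, \<open>n + 1\<close> and \<open>n + 2\<close>
      overlap, so besides \<open>u\<close> and \<open>v\<close> two more reciprocals
      suffice.\<close>
    define w z where "w = 1 / (x - 1)" and "z = 1 / (x - 3)"
    have wz: "(x - 1) * w = 1" "(x - 3) * z = 1" using x by (simp_all add: w_def z_def)
    have F2: "cv_closed_form (n + 2) = a (x + 2) * (H + u + v) + b (x + 2) * (K - u + v) + c (x + 2)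
        - 1/10 + (w + 3 * u) / 320"
      unfolding F r hk sgn using True by (simp add: sgn w_def u_def add.commute)
    have F1: "cv_closed_form (n + 1) = a (x + 1) * (H + u) + b (x + 1) * (K - u) + c (x + 1)
        + 1/10 - (3 * w + u) / 320"
      unfolding F r hk sgn using True by (simp add: sgn w_def u_def)
    have F0: "cv_closed_form n = a x * H + b x * K + c x - 1/10 + (z + 3 * w) / 320"
      unfolding F r hk sgn using True by (simp add: w_def z_def)
    have D1: "cross_diag (n + 1) = ((x + 1) ^ 2 - (x + 1) * (H + u - (K - u)) + 1) / 4"
      unfolding cross_diag_closed_form r hk sgn using True by (simp add: u_def)
    have D0: "cross_diag n = (x ^ 2 - x * (H - K)) / 4"
      unfolding cross_diag_closed_form r hk sgn using True by simp
    \<comment> \<open>Each cofactor is the coefficient of the respective reciprocal in the difference, divided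
      by the denominator of that reciprocal.\<close>
    have "(x + 2) * (x + 1) * cv_closed_form (n + 2) - (2 * (x + 1) * x * cv_closed_form (n + 1)
        + (6 - x * (x - 1)) * cv_closed_form n + 2 * (4 * x + 1) + 2 * (cross_diag (n + 1) - cross_diag n)) =
        ((x + 2) * (a (x + 2) - b (x + 2) + 3/320) - 2 * x * (a (x + 1) - b (x + 1) - 1/320) + 1) * ((x + 1) * u - 1)
        + (x + 1) * (a (x + 2) + b (x + 2)) * ((x + 2) * v - 1)
        + (10 * x + 16) / 320 * ((x - 1) * w - 1) + (x + 2) / 320 * ((x - 3) * z - 1)"
      unfolding F2 F1 F0 D1 D0 a_def b_def c_def
      by (simp add: algebra_simps power2_eq_square add_divide_distrib diff_divide_distrib)
    also have "\<dots> = 0" by (simp add: uv wz)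
    finally show ?thesis by (simp add: x_def)
  next
    case False
    then have sgn: "(-1::real) ^ n = -1" by simp
    define y w where "y = 1 / x" and "w = 1 / (x - 2)"
    have yw: "x * y = 1" "(x - 2) * w = 1" using x by (simp_all add: y_def w_def)
    have F2: "cv_closed_form (n + 2) = a (x + 2) * (H + u + v) + b (x + 2) * (K + u - v) + c (x + 2)
        + 1/10 - (3 * y + v) / 320"
      unfolding F r hk sgn using False by (simp add: sgn y_def u_def v_def)
    have F1: "cv_closed_form (n + 1) = a (x + 1) * (H + u) + b (x + 1) * (K + u) + c (x + 1)
        - 1/10 + (w + 3 * y) / 320"
      unfolding F r hk sgn using False by (simp add: sgn w_def y_def u_def)
    have F0: "cv_closed_form n = a x * H + b x * K + c x + 1/10 - (3 * w + y) / 320"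
      unfolding F r hk sgn using False by (simp add: w_def y_def)
    \<comment> \<open>Since \<open>n + 1\<close> is even, both harmonic sums grow by
      \<open>u\<close>, which cancels in their difference.\<close>
    have D1: "cross_diag (n + 1) = ((x + 1) ^ 2 - (x + 1) * (H - K)) / 4"
      unfolding cross_diag_closed_form r hk sgn using False by (simp add: u_def)
    have D0: "cross_diag n = (x ^ 2 - x * (H - K) + 1) / 4"
      unfolding cross_diag_closed_form r hk sgn using False by simp
    \<comment> \<open>The cofactors arise as in the even case, now with the poles at
      \<open>x\<close> and \<open>x - 2\<close>.\<close>
    have "(x + 2) * (x + 1) * cv_closed_form (n + 2) - (2 * (x + 1) * x * cv_closed_form (n + 1)
        + (6 - x * (x - 1)) * cv_closed_form n + 2 * (4 * x + 1) + 2 * (cross_diag (n + 1) - cross_diag n)) =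
        ((x + 2) * (a (x + 2) + b (x + 2)) - 2 * x * (a (x + 1) + b (x + 1))) * ((x + 1) * u - 1)
        + (x + 1) * (a (x + 2) - b (x + 2) - 1/320) * ((x + 2) * v - 1)
        - (10 * x + 14) / 320 * (x * y - 1) - (5 * x + 9) / 320 * ((x - 2) * w - 1)"
      unfolding F2 F1 F0 D1 D0 a_def b_def c_def
      by (simp add: algebra_simps power2_eq_square add_divide_distrib diff_divide_distrib)
    also have "\<dots> = 0" by (simp add: uv yw)
    finally show ?thesis by (simp add: x_def)
  qed
qed

lemma cv_cost_closed_form: "n \<ge> 4 \<Longrightarrow> cv_cost n = cv_closed_form n"
proof (induction n rule: less_induct)
  case (less n)
  note rec = cv_cost_second_difference
  note small = cross_diag_closed_form harm_expand alt_harm_numeral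
  have c0: "cv_cost 0 = 0" and c1: "cv_cost (Suc 0) = 0" by (simp_all add: cv_cost.simps)
  \<comment> \<open>The initial values come from iterating the three-term recurrence, which avoids
    unfolding the double sum.\<close>
  have c2: "cv_cost 2 = 1"
    using rec[of 0] by (simp add: c0 c1 small flip: numeral_2_eq_2)
  have c3: "cv_cost 3 = 7/3"
    using rec[of 1] c2 by (simp add: c0 c1 small flip: numeral_2_eq_2)
  have c4: "cv_cost 4 = 17/4"
    using rec[of 2] c2 c3 by (simp add: small)
  have c5: "cv_cost 5 = 389/60"
    using rec[of 3] c3 c4 by (simp add: small)
  \<comment> \<open>The recurrence reaches back two places and the closed form is available from 4
    on, hence two base cases.\<close>
  consider "n = 4" | "n = 5" | m where "n = m + 2" "m \<ge> 4"
    using less.prems that(3)[of "n - 2"] by force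
  then show ?case
  proof cases
    case 1
    then show ?thesis
      by (simp add: c4 cv_closed_form_def small)
  next
    case 2
    then show ?thesis
      by (simp add: c5 cv_closed_form_def small)
  next
    case 3
    then have "(real m + 2) * (real m + 1) * cv_cost n = (real m + 2) * (real m + 1) * cv_closed_form n"
      using rec[of m] cv_closed_form_rec[of m] less.IH[of m] less.IH[of "m + 1"] by simp
    moreover have "(real m + 2) * (real m + 1) \<noteq> 0" by (simp add: add_eq_0_iff)
    ultimately show ?thesis by simp
  qed
qed

theorem theoremB3:
  fixes A :: "'a::linorder set" and n :: nat
  assumes "finite A" and "card A = n" and "n \<ge> 4"
  shows "expected_cv_comparisons A =
           9/5 * real n * harm n + 1/5 * real n * alt_harm n - 89/25 * real n
           + 77/40 * harm n + 3/40 * alt_harm n + 67/800 - (-1) ^ n / 10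
           + of_bool (even n) / 320 * (1 / (real n - 3) + 3 / (real n - 1))
           - of_bool (odd n) / 320 * (3 / (real n - 2) + 1 / real n)"
  using expected_cv_comparisons_eq_cv_cost[OF assms(1)] cv_cost_closed_form[OF assms(3)] assms(2)
  by (simp add: cv_closed_form_def)

end
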